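(* For every $n\ge 3$ and every $k$ with $1\le k\le n$, there exists a directed cycle graph $C_n$ on $n$ vertices such that $\operatorname{Pic}(C_n)\cong\mathbb{Z}\times\operatorname{Jac}(C_n)$ with $\operatorname{Jac}(C_n)\cong\mathbb{Z}_k$.
   Context: A directed cycle graph $C_n$ ($n\ge3$) is a directed graph whose underlying undirected graph is the cycle graph on $n$ vertices: vertices $v_1,\dots,v_n$ and, for each cyclically consecutive pair $v_i,v_{i+1}$ (indices mod $n$), exactly one arrow, which is either one-directional (in one of the two directions) or bi-directional. A bi-directional arrow between $v_i,v_j$ counts as an arrow from $v_i$ to $v_j$ and as one from $v_j$ to $v_i$. The Laplacian $L_G$ of a directed graph $G$ on $v_1,\dots,v_n$ is the $n\times n$ integer matrix with $(i,i)$ entry the number of outgoing arrows of $v_i$ and $(i,j)$ entry ($i\neq j$) minus the number of arrows from $v_i$ to $v_j$. $\operatorname{Pic}(G)=\mathbb{Z}^n/L_G^T\mathbb{Z}^n$, $\operatorname{Jac}(G)$ is its torsion subgroup, and $\mathbb{Z}_k=\mathbb{Z}/k\mathbb{Z}$ (so $\mathbb{Z}_1=0$). *)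

theory Defs
  imports
    "HOL-Algebra.Coset"
    "HOL-Algebra.Elementary_Groups"
    "Graph_Theory.Digraph_Component"
    "Jordan_Normal_Form.Matrix"
begin

text \<open>Digraphs whose vertex set is \<open>{0..<n}\<close>; the vertex \<open>v\<^sub>i\<close> is represented
  by the number \<open>i - 1\<close>.\<close>

definition laplacian :: "(nat, 'b) pre_digraph \<Rightarrow> int mat" where
  "laplacian G =
     mat (card (verts G)) (card (verts G))
       (\<lambda>(i, j). if i = j then int (out_degree G i)
                 else - int (card {e \<in> arcs G. tail G e = i \<and> head G e = j}))"

text \<open>The group \<open>monoid_vec TYPE(int) n\<close> is the additive group of integer vectors of
  length \<open>n\<close>, written multiplicatively as required by \<open>Mod\<close>.\<close>

definition Pic :: "(nat, 'b) pre_digraph \<Rightarrow> int vec set monoid" where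
  "Pic G =
     (let n = card (verts G)
      in monoid_vec TYPE(int) n Mod ((\<lambda>x. (laplacian G)\<^sup>T *\<^sub>v x) ` carrier_vec n))"

definition torsion_subgroup :: "('a, 'c) monoid_scheme \<Rightarrow> 'a set" where
  "torsion_subgroup H =
     {x \<in> carrier H. \<exists>m::nat. 0 < m \<and> x [^]\<^bsub>H\<^esub> m = \<one>\<^bsub>H\<^esub>}"

definition Jac :: "(nat, 'b) pre_digraph \<Rightarrow> int vec set monoid" where
  "Jac G = (Pic G)\<lparr>carrier := torsion_subgroup (Pic G)\<rparr>"

text \<open>An undirected graph is encoded as a symmetric digraph, as in \<open>mk_symmetric\<close>.\<close>

definition cycle_graph :: "nat \<Rightarrow> nat pair_pre_digraph" where
  "cycle_graph n =
     \<lparr>pverts = {0..<n},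
      parcs = (\<Union>i\<in>{0..<n}. {(i, (i + 1) mod n), ((i + 1) mod n, i)})\<rparr>"

text \<open>A bi-directional arrow is the presence of both \<open>(i, j)\<close> and \<open>(j, i)\<close>. Since the arcs of a
  \<open>pair_pre_digraph\<close> form a set of pairs, there are no parallel arrows, so that each pair of
  consecutive vertices carries exactly one one-directional or bi-directional arrow.\<close>

definition directed_cycle_graph :: "nat \<Rightarrow> nat pair_pre_digraph \<Rightarrow> bool" where
  "directed_cycle_graph n G \<longleftrightarrow> 3 \<le> n \<and> mk_symmetric (with_proj G) = cycle_graph n"

lemma directed_cycle_graph_iff:
  "directed_cycle_graph n G \<longleftrightarrow>
     3 \<le> n \<and> pverts G = {0..<n} \<and>
     (\<forall>i<n. (i, (i + 1) mod n) \<in> parcs G \<or> ((i + 1) mod n, i) \<in> parcs G) \<and>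
     (\<forall>(i, j)\<in>parcs G. i < n \<and> j < n \<and> (j = (i + 1) mod n \<or> i = (j + 1) mod n))"
  (is "?L \<longleftrightarrow> ?R")
proof
  assume ?L
  then have n: "3 \<le> n" and v: "pverts G = {0..<n}"
    and a: "(\<Union>e\<in>parcs G. {(fst e, snd e), (snd e, fst e)})
       = (\<Union>i\<in>{0..<n}. {(i, (i + 1) mod n), ((i + 1) mod n, i)})"
    by (simp_all add: directed_cycle_graph_def mk_symmetric_def cycle_graph_def with_proj_simps)
  have "(i, (i + 1) mod n) \<in> parcs G \<or> ((i + 1) mod n, i) \<in> parcs G" if "i < n" for i
  proof -
    have "(i, (i + 1) mod n) \<in> (\<Union>e\<in>parcs G. {(fst e, snd e), (snd e, fst e)})"
      unfolding a using that by auto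
    then show ?thesis by auto
  qed
  moreover have "i < n \<and> j < n \<and> (j = (i + 1) mod n \<or> i = (j + 1) mod n)"
    if "(i, j) \<in> parcs G" for i j
  proof -
    have "(i, j) \<in> (\<Union>e\<in>parcs G. {(fst e, snd e), (snd e, fst e)})"
      using that by force
    then show ?thesis unfolding a using n by auto
  qed
  ultimately show ?R using n v by blast
next
  assume R: ?R
  have "(\<Union>e\<in>parcs G. {(fst e, snd e), (snd e, fst e)})
       = (\<Union>i\<in>{0..<n}. {(i, (i + 1) mod n), ((i + 1) mod n, i)})" (is "?A = ?B")
  proof
    show "?A \<subseteq> ?B" using R by fastforce
    show "?B \<subseteq> ?A"
    proof
      fix p assume "p \<in> ?B"
      then obtain i where i: "i < n" "p = (i, (i + 1) mod n) \<or> p = ((i + 1) mod n, i)"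
        by auto
      from R i(1) consider "(i, (i + 1) mod n) \<in> parcs G" | "((i + 1) mod n, i) \<in> parcs G"
        by blast
      then show "p \<in> ?A"
      proof cases
        case 1
        then show ?thesis using i(2) by (intro UN_I[of "(i, (i + 1) mod n)"]) auto
      next
        case 2
        then show ?thesis using i(2) by (intro UN_I[of "((i + 1) mod n, i)"]) auto
      qed
    qed
  qed
  with R show ?L
    by (simp add: directed_cycle_graph_def mk_symmetric_def cycle_graph_def with_proj_simps)
qed

lemma comm_group_monoid_vec: "comm_group (monoid_vec TYPE(int) n)"
proof -
  interpret comm_monoid "monoid_vec TYPE(int) n" by (rule comm_monoid_vec)
  show ?thesis
  proof (unfold_locales, unfold Units_def, safe)
    fix x :: "int vec" assume x: "x \<in> carrier (monoid_vec TYPE(int) n)"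
    then show "\<exists>y\<in>carrier (monoid_vec TYPE(int) n).
        y \<otimes>\<^bsub>monoid_vec TYPE(int) n\<^esub> x = \<one>\<^bsub>monoid_vec TYPE(int) n\<^esub> \<and>
        x \<otimes>\<^bsub>monoid_vec TYPE(int) n\<^esub> y = \<one>\<^bsub>monoid_vec TYPE(int) n\<^esub>"
      by (intro bexI[of _ "- x"]) (auto simp: monoid_vec_simps)
  qed
qed

lemma comm_group_Pic: "comm_group (Pic G)"
proof -
  define n where "n = card (verts G)"
  interpret comm_group "monoid_vec TYPE(int) n" by (rule comm_group_monoid_vec)
  have L: "(laplacian G)\<^sup>T \<in> carrier_mat n n" by (simp add: laplacian_def n_def)
  have "(\<lambda>x. (laplacian G)\<^sup>T *\<^sub>v x) \<in> hom (monoid_vec TYPE(int) n) (monoid_vec TYPE(int) n)"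
    using L by (auto simp: hom_def monoid_vec_simps mult_add_distrib_mat_vec)
  then interpret group_hom "monoid_vec TYPE(int) n" "monoid_vec TYPE(int) n"
      "\<lambda>x. (laplacian G)\<^sup>T *\<^sub>v x"
    by unfold_locales
  show ?thesis
    using abelian_FactGroup[OF img_is_subgroup]
    by (simp add: Pic_def Let_def n_def[symmetric] monoid_vec_simps)
qed

end

theory Submission
  imports Defs
begin

text \<open>Take the digraph with arrows \<open>i \<rightarrow> i + 1\<close> for all \<open>i \<noteq> 0\<close> and \<open>i \<rightarrow> i - 1\<close> for \<open>1 \<le> i < k\<close>
  (indices modulo \<open>n\<close>), so that for \<open>k \<ge> 2\<close> the vertex \<open>0\<close> is a sink. In \<open>Pic\<close> the differences
  \<open>d\<^sub>i = e\<^bsub>i+1\<^esub> - e\<^sub>i\<close> satisfy \<open>d\<^sub>0 = \<dots> = d\<^bsub>k-1\<^esub>\<close> and \<open>d\<^sub>k = \<dots> = d\<^bsub>n-1\<^esub> = 0\<close>, and as they sum to zero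
  around the cycle, the only further relation is \<open>k d\<^sub>0 = 0\<close>. So \<open>e\<^sub>i = e\<^sub>0 + min i k \<cdot> d\<^sub>0\<close>, and the
  degree together with the weighted degree \<open>\<Sum>i. min i k \<cdot> v\<^sub>i\<close> modulo \<open>k\<close> identifies \<open>Pic\<close>
  with \<open>\<int> \<times> \<int>\<^sub>k\<close>.\<close>

section \<open>Torsion subgroups\<close>

text \<open>Homomorphisms commute with powers, and injectivity reflects triviality of a power, so
  torsion passes both ways.\<close>

lemma iso_torsion_subgroup:
  assumes "group G" "group H" and f: "f \<in> iso G H"
  shows "f \<in> iso (G\<lparr>carrier := torsion_subgroup G\<rparr>) (H\<lparr>carrier := torsion_subgroup H\<rparr>)"
proof -
  have hom: "f \<in> hom G H" and bij: "bij_betw f (carrier G) (carrier H)"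
    using f by (auto simp: iso_def)
  interpret group_hom G H f using assms hom by (simp add: group_hom_def group_hom_axioms_def)
  have tors: "f x \<in> torsion_subgroup H \<longleftrightarrow> x \<in> torsion_subgroup G" if x: "x \<in> carrier G" for x
  proof -
    have "f x [^]\<^bsub>H\<^esub> m = \<one>\<^bsub>H\<^esub> \<longleftrightarrow> x [^]\<^bsub>G\<^esub> m = \<one>\<^bsub>G\<^esub>" for m :: nat
      using inj_on_eq_iff[OF bij_betw_imp_inj_on[OF bij], of "x [^]\<^bsub>G\<^esub> m" "\<one>\<^bsub>G\<^esub>"] x
      by (simp add: hom_nat_pow)
    then show ?thesis using x by (simp add: torsion_subgroup_def)
  qed
  have "bij_betw f (torsion_subgroup G) (torsion_subgroup H)"
  proof (rule bij_betw_subset[OF bij])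
    show "torsion_subgroup G \<subseteq> carrier G" by (auto simp: torsion_subgroup_def)
    show "f ` torsion_subgroup G = torsion_subgroup H"
    proof
      show "f ` torsion_subgroup G \<subseteq> torsion_subgroup H"
        using tors by (auto simp: torsion_subgroup_def)
      show "torsion_subgroup H \<subseteq> f ` torsion_subgroup G"
      proof
        fix y assume y: "y \<in> torsion_subgroup H"
        then have "y \<in> f ` carrier G"
          using bij by (auto simp: torsion_subgroup_def bij_betw_def)
        then show "y \<in> f ` torsion_subgroup G" using y tors by auto
      qed
    qed
  qed
  then show ?thesis
    using hom bij_betwE[of f "torsion_subgroup G" "torsion_subgroup H"]
    by (auto simp: iso_def hom_def torsion_subgroup_def)
qed

text \<open>The integers are torsion-free and \<open>k\<close> kills the second factor; for
  \<open>k = 0\<close> that factor would be the integers again.\<close>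

lemma torsion_subgroup_int_DirProd:
  assumes "1 \<le> k"
  shows "torsion_subgroup (integer_group \<times>\<times> integer_mod_group k)
           = {0} \<times> carrier (integer_mod_group k)"
proof -
  have pow: "(a, b) [^]\<^bsub>integer_group \<times>\<times> integer_mod_group k\<^esub> (m::nat)
               = (a * int m, (int m * b) mod int k)" for a b m
  proof (induction m)
    case 0
    then show ?case by simp
  next
    case (Suc m)
    then show ?case
      by (simp add: algebra_simps mod_simps)
  qed
  show ?thesis
  proof
    show "torsion_subgroup (integer_group \<times>\<times> integer_mod_group k)
            \<subseteq> {0} \<times> carrier (integer_mod_group k)"
      by (auto simp: torsion_subgroup_def pow)
    have "\<exists>m>0. int m * b mod int k = 0" for b
      using assms by (intro exI[of _ k]) auto
    then show "{0} \<times> carrier (integer_mod_group k)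
            \<subseteq> torsion_subgroup (integer_group \<times>\<times> integer_mod_group k)"
      by (auto simp: torsion_subgroup_def pow)
  qed
qed

text \<open>Reduces the theorem to a single isomorphism for \<open>Pic\<close>.\<close>

lemma iso_torsion_int_DirProd:
  assumes "1 \<le> k" "group P" "P \<cong> integer_group \<times>\<times> integer_mod_group k"
  shows "P\<lparr>carrier := torsion_subgroup P\<rparr> \<cong> integer_mod_group k"
    and "P \<cong> integer_group \<times>\<times> P\<lparr>carrier := torsion_subgroup P\<rparr>"
proof -
  let ?Q = "integer_group \<times>\<times> integer_mod_group k"
  let ?J = "P\<lparr>carrier := torsion_subgroup P\<rparr>"
  have Q: "group ?Q" by (simp add: DirProd_group)
  obtain f where f: "f \<in> iso ?Q P"
    using group.iso_sym[OF assms(2,3)] by (auto simp: is_iso_def)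
  have "(\<lambda>b. (0, b)) \<in> iso (integer_mod_group k) (?Q\<lparr>carrier := torsion_subgroup ?Q\<rparr>)"
    by (auto simp: torsion_subgroup_int_DirProd[OF assms(1)] iso_def hom_def bij_betw_def
        inj_on_def image_iff)
  then have "f \<circ> (\<lambda>b. (0, b)) \<in> iso (integer_mod_group k) ?J"
    using iso_torsion_subgroup[OF Q assms(2) f] by (rule iso_set_trans)
  then have iso: "integer_mod_group k \<cong> ?J" by (rule is_isoI)
  then show "?J \<cong> integer_mod_group k"
    by (rule group.iso_sym[OF group_integer_mod_group])
  have "?Q \<cong> integer_group \<times>\<times> ?J"
    by (rule group.DirProd_iso_trans[OF group_integer_group iso_refl iso])
  with assms(3) show "P \<cong> integer_group \<times>\<times> ?J" by (rule iso_trans)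
qed

section \<open>Integer combinations of rows\<close>

definition row_span :: "nat \<Rightarrow> (nat \<Rightarrow> nat \<Rightarrow> int) \<Rightarrow> (nat \<Rightarrow> int) set" where
  "row_span n L = {f. \<exists>c. \<forall>j<n. f j = (\<Sum>i<n. c i * L i j)}"

lemma row_span_cong: "(\<And>j. j < n \<Longrightarrow> f j = g j) \<Longrightarrow> f \<in> row_span n L \<Longrightarrow> g \<in> row_span n L"
  by (auto simp: row_span_def)

lemma row_span_row: "i < n \<Longrightarrow> L i \<in> row_span n L"
  unfolding row_span_def
  by (auto intro!: exI[of _ "\<lambda>h. of_bool (h = i)"])

lemma row_span_zero: "(\<lambda>j. 0) \<in> row_span n L"
  unfolding row_span_def by (auto intro!: exI[of _ "\<lambda>h. 0"])

lemma row_span_lincomb: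
  assumes "f \<in> row_span n L" "g \<in> row_span n L"
  shows "(\<lambda>j. a * f j + b * g j) \<in> row_span n L"
proof -
  obtain c d where "\<forall>j<n. f j = (\<Sum>i<n. c i * L i j)" "\<forall>j<n. g j = (\<Sum>i<n. d i * L i j)"
    using assms by (auto simp: row_span_def)
  then have "\<forall>j<n. a * f j + b * g j = (\<Sum>i<n. (a * c i + b * d i) * L i j)"
    by (simp add: sum_distrib_left sum.distrib algebra_simps)
  then show ?thesis
    unfolding row_span_def by (intro CollectI exI[of _ "\<lambda>i. a * c i + b * d i"])
qed

lemma row_span_sum:
  fixes m :: nat
  assumes "\<And>i. i < m \<Longrightarrow> f i \<in> row_span n L"
  shows "(\<lambda>j. \<Sum>i<m. a i * f i j) \<in> row_span n L"
  using assms
proof (induction m)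
  case 0
  then show ?case by (simp add: row_span_zero)
next
  case (Suc m)
  have "(\<lambda>j. 1 * (\<Sum>i<m. a i * f i j) + a m * f m j) \<in> row_span n L"
    by (intro row_span_lincomb Suc) (auto intro: Suc)
  then show ?case by simp
qed

text \<open>Multiplying by the transpose combines the rows of \<open>A\<close>, so the lattice
  factored out in \<open>Pic\<close> becomes a \<open>row_span\<close>.\<close>

lemma transpose_image_eq_row_span:
  fixes A :: "int mat"
  assumes A: "A \<in> carrier_mat n n"
  shows "(\<lambda>x. A\<^sup>T *\<^sub>v x) ` carrier_vec n
           = {v \<in> carrier_vec n. vec_index v \<in> row_span n (\<lambda>i j. A $$ (i, j))}"
proof -
  have entry: "(A\<^sup>T *\<^sub>v x) $ j = (\<Sum>i<n. x $ i * A $$ (i, j))" if "x \<in> carrier_vec n" "j < n" for x j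
    using that A by (auto simp: scalar_prod_def lessThan_atLeast0 mult.commute intro!: sum.cong)
  show ?thesis
  proof
    show "(\<lambda>x. A\<^sup>T *\<^sub>v x) ` carrier_vec n
           \<subseteq> {v \<in> carrier_vec n. vec_index v \<in> row_span n (\<lambda>i j. A $$ (i, j))}"
      using A entry by (auto simp: row_span_def)
    show "{v \<in> carrier_vec n. vec_index v \<in> row_span n (\<lambda>i j. A $$ (i, j))}
           \<subseteq> (\<lambda>x. A\<^sup>T *\<^sub>v x) ` carrier_vec n"
    proof clarify
      fix v :: "int vec" assume v: "v \<in> carrier_vec n" "vec_index v \<in> row_span n (\<lambda>i j. A $$ (i, j))"
      then obtain c where c: "\<forall>j<n. v $ j = (\<Sum>i<n. c i * A $$ (i, j))"
        by (auto simp: row_span_def)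
      have "v = A\<^sup>T *\<^sub>v vec n c"
        using A v(1) c entry[of "vec n c"] by (intro eq_vecI) auto
      then show "v \<in> (\<lambda>x. A\<^sup>T *\<^sub>v x) ` carrier_vec n" by auto
    qed
  qed
qed

section \<open>The Laplacian of a simple digraph\<close>

text \<open>Each arrow from \<open>i\<close> to \<open>h\<close> adds e_i - e_h to row
  \<open>i\<close>. A loop would add zero here but count in \<open>out_degree\<close>.\<close>

lemma laplacian_with_proj_index:
  assumes V: "pverts G = {0..<n}" and fin: "finite (parcs G)" and loopfree: "(i, i) \<notin> parcs G"
    and ij: "i < n" "j < n"
  shows "laplacian (with_proj G) $$ (i, j)
           = (\<Sum>h\<in>{h. (i, h) \<in> parcs G}. of_bool (j = i) - of_bool (j = h))"
proof -
  let ?N = "{h. (i, h) \<in> parcs G}"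
  have finN: "finite ?N"
    using finite_imageI[OF fin, of snd] by (rule finite_subset[rotated]) force
  have "card {e \<in> parcs G. fst e = i} = card ?N"
    by (rule bij_betw_same_card[of snd]) (force simp: bij_betw_def inj_on_def)
  moreover have "{e \<in> parcs G. fst e = i \<and> snd e = j} = (if j \<in> ?N then {(i, j)} else {})"
    by auto
  moreover have "(\<Sum>h\<in>?N. of_bool (j = h)) = (of_bool (j \<in> ?N) :: int)"
    using finN by (simp add: of_bool_def sum.delta')
  ultimately show ?thesis
    using V ij loopfree finN
    by (auto simp: laplacian_def out_degree_def out_arcs_def sum_subtractf with_proj_simps)
qed

section \<open>The digraph\<close>

text \<open>For \<open>k = 1\<close> no arrow would join \<open>0\<close> and \<open>1\<close>; the extra arrow \<open>0 \<rightarrow> 1\<close> only adds the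
  relation \<open>d\<^sub>0 = 0\<close>, which \<open>k d\<^sub>0 = 0\<close> already contains.\<close>

definition twisted_cycle :: "nat \<Rightarrow> nat \<Rightarrow> nat pair_pre_digraph" where
  "twisted_cycle n k =
     \<lparr>pverts = {0..<n},
      parcs = {(i, (i + 1) mod n) | i. 1 \<le> i \<and> i < n} \<union> {(i, i - 1) | i. 1 \<le> i \<and> i < k}
                \<union> (if k = 1 then {(0, 1)} else {})\<rparr>"

definition out_nbs :: "nat \<Rightarrow> nat \<Rightarrow> nat \<Rightarrow> nat set" where
  "out_nbs n k i = (if i = 0 then if k = 1 then {1} else {}
                else if i < k then {(i + 1) mod n, i - 1} else {(i + 1) mod n})"

definition wt :: "nat \<Rightarrow> nat \<Rightarrow> int" where "wt k i = int (min i k)"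

context
  fixes n k :: nat
  assumes n: "3 \<le> n" and k: "1 \<le> k" "k \<le> n"
begin

lemma directed_cycle_graph_twisted_cycle: "directed_cycle_graph n (twisted_cycle n k)"
proof -
  \<comment> \<open>Only the edge between 0 and 1 lacks a guaranteed forward arrow:
    \<open>(1, 0)\<close> covers it if \<open>k\<close> is at least 2, the extra arrow if
    \<open>k = 1\<close>.\<close>
  have "(i, (i + 1) mod n) \<in> parcs (twisted_cycle n k) \<or> ((i + 1) mod n, i) \<in> parcs (twisted_cycle n k)"
    if "i < n" for i
    using that n k by (cases "i = 0") (auto simp: twisted_cycle_def)
  moreover have "i < n \<and> j < n \<and> (j = (i + 1) mod n \<or> i = (j + 1) mod n)"
    if "(i, j) \<in> parcs (twisted_cycle n k)" for i j
    using that n k by (auto simp: twisted_cycle_def split: if_splits)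
  moreover have "pverts (twisted_cycle n k) = {0..<n}" by (simp add: twisted_cycle_def)
  ultimately show ?thesis
    using n unfolding directed_cycle_graph_iff by blast
qed

abbreviation lap :: "nat \<Rightarrow> nat \<Rightarrow> int" where
  "lap i j \<equiv> laplacian (with_proj (twisted_cycle n k)) $$ (i, j)"

lemma twisted_cycle_out_nbs: "i < n \<Longrightarrow> {h. (i, h) \<in> parcs (twisted_cycle n k)} = out_nbs n k i"
  using n k by (auto simp: twisted_cycle_def out_nbs_def)

lemma out_nbs_less: "i < n \<Longrightarrow> h \<in> out_nbs n k i \<Longrightarrow> h < n"
  using n by (auto simp: out_nbs_def split: if_splits)

lemma lap_eq:
  assumes "i < n" "j < n"
  shows "lap i j = (\<Sum>h\<in>out_nbs n k i. of_bool (j = i) - of_bool (j = h))"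
proof -
  have "parcs (twisted_cycle n k) \<subseteq> {0..<n} \<times> {0..<n}"
    using n k by (auto simp: twisted_cycle_def split: if_splits)
  then have "finite (parcs (twisted_cycle n k))"
    by (rule finite_subset) simp
  moreover have pverts: "pverts (twisted_cycle n k) = {0..<n}"
    by (simp add: twisted_cycle_def)
  moreover have "(i, i) \<notin> parcs (twisted_cycle n k)"
    using n k assms(1) by (auto simp: twisted_cycle_def mod_Suc)
  ultimately show ?thesis
    using assms laplacian_with_proj_index[of "twisted_cycle n k" n i j]
    by (simp add: pverts twisted_cycle_out_nbs)
qed

section \<open>Invariants of the row lattice\<close>

lemma sum_lap:
  assumes "i < n"
  shows "(\<Sum>j<n. w j * lap i j) = (\<Sum>h\<in>out_nbs n k i. w i - w h)"
proof -
  have "(\<Sum>j<n. w j * lap i j)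
      = (\<Sum>j<n. \<Sum>h\<in>out_nbs n k i. w j * (of_bool (j = i) - of_bool (j = h)))"
    using assms by (simp add: lap_eq sum_distrib_left)
  also have "\<dots> = (\<Sum>h\<in>out_nbs n k i. \<Sum>j<n. w j * (of_bool (j = i) - of_bool (j = h)))"
    by (rule sum.swap)
  also have "\<dots> = (\<Sum>h\<in>out_nbs n k i. w i - w h)"
    using assms out_nbs_less by (intro sum.cong) (auto simp: right_diff_distrib sum_subtractf)
  finally show ?thesis .
qed

text \<open>The weight rises by one per step up to \<open>k\<close> and then stays constant, so the
  drops cancel at all vertices other than 0 and \<open>n - 1\<close>. At \<open>n - 1\<close> the
  arrow back to 0 makes the sum exactly \<open>k\<close>. Vertex 0 has an arrow only for
  \<open>k = 1\<close>, where divisibility is trivial.\<close>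

lemma wt_row_dvd:
  assumes "i < n"
  shows "int k dvd (\<Sum>h\<in>out_nbs n k i. wt k i - wt k h)"
proof -
  consider "i = 0" | "1 \<le> i" "i < k" "i + 1 < n" | "1 \<le> i" "i < k" "i + 1 = n" | "1 \<le> i" "k \<le> i" "i + 1 < n"
    | "1 \<le> i" "k \<le> i" "i + 1 = n"
    using assms by linarith
  then show ?thesis
  proof cases
    case 3
    then have "(i + 1) mod n = 0" "k = n" "i - 1 \<noteq> 0" using k n by auto
    then have "out_nbs n k i = {0, i - 1}" "0 \<noteq> i - 1" using 3 by (auto simp: out_nbs_def)
    moreover have "int i + 1 = int k" using 3 \<open>k = n\<close> by simp
    ultimately show ?thesis using 3 by (simp add: wt_def of_nat_diff)
  next
    case 5
    then have "out_nbs n k i = {0}" by (simp add: out_nbs_def)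
    then show ?thesis using 5 by (simp add: wt_def)
  qed (use k n in \<open>auto simp: out_nbs_def wt_def min_def of_nat_diff\<close>)
qed

lemma row_span_lap_relations:
  assumes "f \<in> row_span n lap"
  shows "(\<Sum>j<n. f j) = 0" and "int k dvd (\<Sum>j<n. wt k j * f j)"
proof -
  obtain c where c: "\<And>j. j < n \<Longrightarrow> f j = (\<Sum>i<n. c i * lap i j)"
    using assms by (auto simp: row_span_def)
  \<comment> \<open>By linearity both claims reduce to single rows, with \<open>w\<close> constant
    or \<open>w = wt k\<close>.\<close>
  have w: "(\<Sum>j<n. w j * f j) = (\<Sum>i<n. c i * (\<Sum>h\<in>out_nbs n k i. w i - w h))" for w
  proof -
    have "(\<Sum>j<n. w j * f j) = (\<Sum>j<n. \<Sum>i<n. c i * (w j * lap i j))"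
      by (intro sum.cong) (auto simp: c sum_distrib_left mult.left_commute)
    also have "\<dots> = (\<Sum>i<n. \<Sum>j<n. c i * (w j * lap i j))" by (rule sum.swap)
    also have "\<dots> = (\<Sum>i<n. c i * (\<Sum>h\<in>out_nbs n k i. w i - w h))"
      by (simp add: sum_distrib_left[symmetric] sum_lap)
    finally show ?thesis .
  qed
  show "(\<Sum>j<n. f j) = 0" using w[of "\<lambda>_. 1"] by simp
  show "int k dvd (\<Sum>j<n. wt k j * f j)"
    unfolding w by (intro dvd_sum dvd_mult wt_row_dvd) auto
qed

section \<open>Generating the row lattice\<close>

text \<open>The basis vector \<open>e\<^sub>i\<close>, with \<open>i\<close> read modulo \<open>n\<close> so that walking once around the cycle
  ends at \<open>unit_fun n = unit_fun 0\<close>.\<close>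

definition unit_fun :: "nat \<Rightarrow> nat \<Rightarrow> int" where
  "unit_fun i j = of_bool (j = i mod n)"

definition defect :: "nat \<Rightarrow> nat \<Rightarrow> int" where
  "defect i j = unit_fun i j - unit_fun 0 j - wt k i * (unit_fun 1 j - unit_fun 0 j)"

lemma lap_middle:
  assumes "1 \<le> i" "i < k" "j < n"
  shows "lap i j = 2 * unit_fun i j - unit_fun (i + 1) j - unit_fun (i - 1) j"
proof -
  \<comment> \<open>The two out-neighbours must differ, or the sum over the set would lose a term;
    at \<open>i + 1 = n\<close> this rests on \<open>n\<close> being at least 3.\<close>
  have "(i + 1) mod n \<noteq> i - 1" using assms k n by (cases "i + 1 = n") auto
  then show ?thesis using assms k n by (simp add: lap_eq out_nbs_def unit_fun_def)
qed

lemma lap_top: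
  assumes "k \<le> i" "i < n" "j < n"
  shows "lap i j = unit_fun i j - unit_fun (i + 1) j"
  using assms k n by (simp add: lap_eq out_nbs_def unit_fun_def)

text \<open>Row \<open>i - 1\<close> rewrites e_i as 2 e_(i-1) - e_(i-2), a recursion that
  \<open>wt k\<close> also obeys up to \<open>k\<close>; the defects at 0 and 1 vanish.\<close>

lemma defect_low: "i \<le> k \<Longrightarrow> defect i \<in> row_span n lap"
proof (induction i rule: less_induct)
  case (less i)
  consider "i = 0" | "i = 1" | m where "i = Suc (Suc m)"
    by (metis One_nat_def not0_implies_Suc)
  then show ?case
  proof cases
    case 1
    then show ?thesis by (intro row_span_cong[OF _ row_span_zero]) (simp add: defect_def wt_def)
  next
    case 2
    then show ?thesis using k
      by (intro row_span_cong[OF _ row_span_zero]) (simp add: defect_def wt_def)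
  next
    case (3 m)
    have "(\<lambda>j. 1 * (2 * defect (Suc m) j + (-1) * defect m j) + (-1) * lap (Suc m) j) \<in> row_span n lap"
      using less 3 k by (intro row_span_lincomb row_span_row) auto
    then show ?thesis
      by (rule row_span_cong[rotated])
        (use 3 less.prems in \<open>auto simp: lap_middle defect_def wt_def algebra_simps\<close>)
  qed
qed

text \<open>Descends from \<open>n\<close>, where \<open>unit_fun n = unit_fun 0\<close>; each row
  from \<open>k\<close> on identifies e_i with e_(i+1).\<close>

lemma unit_fun_high:
  assumes "k \<le> i" "i \<le> n"
  shows "(\<lambda>j. unit_fun i j - unit_fun 0 j) \<in> row_span n lap"
  using assms(2,1)
proof (induction i rule: inc_induct)
  case base
  show ?case by (intro row_span_cong[OF _ row_span_zero]) (simp add: unit_fun_def)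
next
  case (step i)
  have "(\<lambda>j. 1 * (unit_fun (Suc i) j - unit_fun 0 j) + 1 * lap i j) \<in> row_span n lap"
    using step by (intro row_span_lincomb row_span_row) auto
  then show ?case
    by (rule row_span_cong[rotated]) (use step in \<open>auto simp: lap_top\<close>)
qed

text \<open>The two descriptions of e_k, from below and from above, meet here.\<close>

lemma k_torsion: "(\<lambda>j. int k * (unit_fun 1 j - unit_fun 0 j)) \<in> row_span n lap"
proof -
  have "(\<lambda>j. 1 * (unit_fun k j - unit_fun 0 j) + (-1) * defect k j) \<in> row_span n lap"
    using k by (intro row_span_lincomb unit_fun_high defect_low) auto
  then show ?thesis
    by (rule row_span_cong[rotated]) (auto simp: defect_def wt_def)
qed

lemma defect_in_row_span:
  assumes "i < n"
  shows "defect i \<in> row_span n lap"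
proof (cases "i \<le> k")
  case False
  have "(\<lambda>j. 1 * (unit_fun i j - unit_fun 0 j) + (-1) * (int k * (unit_fun 1 j - unit_fun 0 j)))
          \<in> row_span n lap"
    using assms False by (intro row_span_lincomb unit_fun_high k_torsion) auto
  then show ?thesis
    by (rule row_span_cong[rotated]) (use False in \<open>auto simp: defect_def wt_def\<close>)
qed (rule defect_low)

lemma row_span_lap_iff:
  "f \<in> row_span n lap \<longleftrightarrow> (\<Sum>j<n. f j) = 0 \<and> int k dvd (\<Sum>j<n. wt k j * f j)"
proof
  assume "(\<Sum>j<n. f j) = 0 \<and> int k dvd (\<Sum>j<n. wt k j * f j)"
  then obtain m where deg: "(\<Sum>j<n. f j) = 0" and m: "(\<Sum>j<n. wt k j * f j) = int k * m"
    by (auto simp: dvd_def)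
  \<comment> \<open>Writing f as the sum of f_i e_i and splitting off the defects leaves deg(f) e_0
    plus the weighted degree times e_1 - e_0. The first vanishes and the second is \<open>m\<close>
    times the relation \<open>k_torsion\<close>.\<close>
  have "(\<lambda>j. 1 * (\<Sum>i<n. f i * defect i j) + m * (int k * (unit_fun 1 j - unit_fun 0 j)))
          \<in> row_span n lap"
    by (intro row_span_lincomb row_span_sum k_torsion defect_in_row_span)
  then show "f \<in> row_span n lap"
  proof (rule row_span_cong[rotated])
    fix j assume j: "j < n"
    have "(\<Sum>i<n. f i * defect i j) = (\<Sum>i<n. f i * unit_fun i j) - (\<Sum>i<n. f i) * unit_fun 0 j
            - (\<Sum>i<n. wt k i * f i) * (unit_fun 1 j - unit_fun 0 j)"
      unfolding sum_distrib_right sum_subtractf[symmetric]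
      by (intro sum.cong) (simp_all add: defect_def algebra_simps)
    moreover have "(\<Sum>i<n. f i * unit_fun i j) = f j"
      using j by (simp add: unit_fun_def)
    ultimately show "1 * (\<Sum>i<n. f i * defect i j) + m * (int k * (unit_fun 1 j - unit_fun 0 j)) = f j"
      by (simp add: deg m)
  qed
qed (auto dest: row_span_lap_relations)

section \<open>The Picard group\<close>

definition deg_wt :: "int vec \<Rightarrow> int \<times> int" where
  "deg_wt v = ((\<Sum>i<n. v $ i), (\<Sum>i<n. wt k i * v $ i) mod int k)"

text \<open>First isomorphism theorem: \<open>row_span_lap_iff\<close> says that the Laplacian
  lattice is the kernel of \<open>deg_wt\<close>.\<close>

lemma Pic_twisted_cycle:
  "Pic (with_proj (twisted_cycle n k)) \<cong> integer_group \<times>\<times> integer_mod_group k"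
proof -
  let ?V = "monoid_vec TYPE(int) n" and ?Q = "integer_group \<times>\<times> integer_mod_group k"
  interpret V: comm_group ?V by (rule comm_group_monoid_vec)
  interpret Q: group ?Q by (simp add: DirProd_group)
  have "deg_wt \<in> hom ?V ?Q"
    using k by (auto simp: hom_def deg_wt_def monoid_vec_simps carrier_integer_mod_group
        sum.distrib distrib_left mod_simps)
  then interpret group_hom ?V ?Q deg_wt by unfold_locales
  have surj: "\<exists>v\<in>carrier_vec n. deg_wt v = (a, b)" if b: "b \<in> carrier (integer_mod_group k)" for a b
  proof
    \<comment> \<open>Vertices 0 and 1 have weights 0 and 1, so \<open>b\<close> at vertex 1 fixes
      the weight and \<open>a - b\<close> at vertex 0 corrects the degree.\<close>
    let ?f = "\<lambda>i::nat. if i = 0 then a - b else if i = 1 then b else 0"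
    show "vec n ?f \<in> carrier_vec n" by simp
    have sum: "(\<Sum>i<n. w i * vec n ?f $ i) = w 0 * (a - b) + w 1 * b" for w :: "nat \<Rightarrow> int"
    proof -
      have "(\<Sum>i<n. w i * vec n ?f $ i) = (\<Sum>i\<in>{0,1}. w i * ?f i)"
        using n by (intro sum.mono_neutral_cong_right) auto
      then show ?thesis by simp
    qed
    show "deg_wt (vec n ?f) = (a, b)"
      using sum[of "\<lambda>_. 1"] sum[of "wt k"] b k
      by (simp add: deg_wt_def wt_def carrier_integer_mod_group)
  qed
  have "deg_wt ` carrier ?V = carrier ?Q"
  proof (intro equalityI subsetI)
    fix p assume "p \<in> carrier ?Q"
    then have "snd p \<in> carrier (integer_mod_group k)" by auto
    from surj[OF this, of "fst p"] show "p \<in> deg_wt ` carrier ?V"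
      by (auto simp: monoid_vec_simps)
  qed (use hom_closed in blast)
  then have "?V Mod kernel ?V ?Q deg_wt \<cong> ?Q" by (rule FactGroup_iso)
  moreover have "Pic (with_proj (twisted_cycle n k)) = ?V Mod kernel ?V ?Q deg_wt"
  proof -
    have card: "card (verts (with_proj (twisted_cycle n k))) = n"
      by (simp add: twisted_cycle_def)
    then have "laplacian (with_proj (twisted_cycle n k)) \<in> carrier_mat n n"
      by (simp add: laplacian_def)
    then show ?thesis
      unfolding Pic_def card Let_def
      by (simp add: transpose_image_eq_row_span row_span_lap_iff kernel_def
          deg_wt_def monoid_vec_simps mod_eq_0_iff_dvd)
  qed
  ultimately show ?thesis by simp
qed

end

theorem theorem4p1:
  fixes n k :: nat
  assumes "3 \<le> n" and "1 \<le> k" and "k \<le> n"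
  shows "\<exists>G. directed_cycle_graph n G
           \<and> Pic (with_proj G) \<cong> integer_group \<times>\<times> Jac (with_proj G)
           \<and> Jac (with_proj G) \<cong> integer_mod_group k"
proof -
  let ?G = "twisted_cycle n k"
  have "group (Pic (with_proj ?G))"
    using comm_group_Pic by (rule comm_group.axioms)
  note iso = iso_torsion_int_DirProd[OF assms(2) this Pic_twisted_cycle[OF assms]]
  show ?thesis
    using directed_cycle_graph_twisted_cycle[OF assms] iso unfolding Jac_def by blast
qed

end
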